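(* Let $\{\mathcal{F}(t)\}_{t\ge0}$ be a filtration and let $\{D(t)\}_{t\ge 0}$ be a non-negative random (scalar) process such that, for all $t\ge0$, $$D(t+1)\le a(t+1)D(t)+b(t)\quad\text{almost surely},$$ where $\{b(t)\}$ is a deterministic sequence and $\{a(t)\}$ is a random process adapted to $\{\mathcal{F}(t)\}$ such that $a(t)\in[0,1]$ and $\mathbb{E}[a(t+1)\mid\mathcal{F}(t)]\le\tilde\lambda$ almost surely, for some constant $\tilde\lambda<1$ and all $t\ge0$. If $b(t)\ge 0$ for all $t\ge 0$ and $b(t)\le Kt^{-\tilde\beta}$ for all $t\ge1$, for some $K,\tilde\beta>0$, then for all $\beta<\tilde\beta$, $\lim_{t\to\infty}D(t)t^\beta=0$ almost surely.
   Context: A filtration is an increasing sequence of sigma-algebras $\mathcal{F}(0)\subseteq\mathcal{F}(1)\subseteq\cdots$ on the underlying probability space; a process is adapted if its value at time $t$ is $\mathcal{F}(t)$-measurable for every $t$. *)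

theory Defs
  imports "HOL-Probability.Probability"
begin

definition adapted_process :: "(nat \<Rightarrow> 'a measure) \<Rightarrow> (nat \<Rightarrow> 'a \<Rightarrow> real) \<Rightarrow> bool" where
  "adapted_process F X \<longleftrightarrow> (\<forall>t. X t \<in> borel_measurable (F t))"

end

theory Submission
  imports Defs "HOL-Real_Asymp.Real_Asymp"
begin

text \<open>
  On the event \<open>D 0 \<le> n\<close> the process \<open>D\<close> is dominated by the solution \<open>Y\<close> of
  \<open>Y (t + 1) = a (t + 1) * Y t + b t\<close> started at the constant \<open>n\<close>; unlike \<open>D\<close>, this process is
  adapted and bounded. Since \<open>a \<in> [0, 1]\<close> we have \<open>a ^ p \<le> a\<close>, so conditioning gives a contraction
  \<open>E (Y (t + 1) ^ p) \<le> \<mu> * E (Y t ^ p) + C * b t ^ p\<close> with \<open>\<mu> < 1\<close> for every exponent \<open>p\<close>. If \<open>p\<close>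
  is so large that \<open>p * (\<beta>' - \<beta>) > 1\<close>, the expectations of \<open>(Y t * t powr \<beta>) ^ p\<close> are summable,
  hence so are these variables almost surely.
\<close>

section \<open>Analytic tools: a power inequality and two summability criteria\<close>

text \<open>For small \<open>d\<close>, if \<open>y \<le> d * x\<close> then \<open>x + y\<close> is
  at most \<open>(1 + d) * x\<close>, which costs only a factor close to 1. Otherwise
  \<open>x\<close> is below \<open>y / d\<close> and is absorbed into the \<open>y\<close> term.
  Since the weight on \<open>x ^ p\<close> is arbitrarily close to 1, a contraction factor below 1
  survives the expansion of the power.\<close>

lemma power_add_le_weighted:
  fixes \<rho> :: real
  assumes "1 < \<rho>"
  obtains C where "0 \<le> C"
    and "\<And>x y. 0 \<le> x \<Longrightarrow> 0 \<le> y \<Longrightarrow> (x + y) ^ p \<le> \<rho> * x ^ p + C * y ^ p"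
proof -
  have "((\<lambda>d. (1 + d) ^ p) \<longlongrightarrow> (1 + 0 :: real) ^ p) (at_right 0)"
    by (intro tendsto_intros)
  then have "eventually (\<lambda>d. (1 + d) ^ p < \<rho>) (at_right (0::real))"
    using assms by (intro order_tendstoD(2)[where y = "(1 + 0) ^ p"]) auto
  moreover have "eventually (\<lambda>d. d > 0) (at_right (0::real))"
    by (simp add: eventually_at_right_less)
  ultimately have "eventually (\<lambda>d. d > 0 \<and> (1 + d) ^ p < \<rho>) (at_right (0::real))"
    by eventually_elim auto
  then obtain d :: real where d: "d > 0" "(1 + d) ^ p < \<rho>"
    using eventually_happens'[OF trivial_limit_at_right_real] by blast
  show thesis
  proof (rule that[of "(1 + 1 / d) ^ p"])
    fix x y :: real
    assume xy: "0 \<le> x" "0 \<le> y"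
    show "(x + y) ^ p \<le> \<rho> * x ^ p + (1 + 1 / d) ^ p * y ^ p"
    proof (cases "y \<le> d * x")
      case True
      then have "(x + y) ^ p \<le> ((1 + d) * x) ^ p"
        using xy by (intro power_mono) (auto simp: algebra_simps)
      also have "\<dots> \<le> \<rho> * x ^ p"
        using d xy by (auto simp: power_mult_distrib intro!: mult_right_mono)
      finally show ?thesis
        using d xy by (simp add: add_increasing2)
    next
      case False
      then have "x \<le> y / d"
        using d by (simp add: field_simps)
      then have "(x + y) ^ p \<le> ((1 + 1 / d) * y) ^ p"
        using xy by (intro power_mono) (auto simp: algebra_simps)
      then show ?thesis
        using assms xy by (simp add: power_mult_distrib add_increasing)
    qed
  qed (use d in auto)
qed

text \<open>Summing the recursion over the first \<open>n\<close> indices bounds a partial sum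
  \<open>S\<close> by a constant plus \<open>r * S\<close>. Since \<open>r < 1\<close>, this can be
  solved for \<open>S\<close>, uniformly in \<open>n\<close>.\<close>

lemma summable_of_contraction:
  fixes u d :: "nat \<Rightarrow> real"
  assumes u: "\<And>t. 0 \<le> u t" and r: "r < 1"
    and d: "summable d" "\<And>t. 0 \<le> d t"
    and step: "eventually (\<lambda>t. u (Suc t) \<le> r * u t + d t) sequentially"
  shows "summable u"
proof -
  obtain N where N: "\<And>t. N \<le> t \<Longrightarrow> u (Suc t) \<le> r * u t + d t"
    using step by (auto simp: eventually_sequentially)
  \<comment> \<open>The shift by \<open>N\<close> turns the eventual recursion into one valid at
    every index.\<close>
  define v where "v t = u (t + N)" for t
  define e where "e t = d (t + N)" for t
  have e: "summable e" "\<And>t. 0 \<le> e t"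
    using d by (simp_all add: e_def[abs_def] summable_iff_shift)
  have v: "0 \<le> v t" "v (Suc t) \<le> r * v t + e t" for t
    using u N[of "t + N"] by (auto simp: v_def e_def)
  have "sum v {..<n} \<le> (v 0 + suminf e) / (1 - r)" for n
  proof -
    have "sum v {..<n} \<le> sum v {..<Suc n}"
      using v by simp
    also have "\<dots> = v 0 + (\<Sum>t<n. v (Suc t))"
      by (simp only: sum.lessThan_Suc_shift)
    also have "\<dots> \<le> v 0 + (r * sum v {..<n} + sum e {..<n})"
      using v(2) by (auto simp: sum_distrib_left simp flip: sum.distrib intro!: sum_mono)
    also have "\<dots> \<le> v 0 + (r * sum v {..<n} + suminf e)"
      using e by (auto intro: sum_le_suminf)
    finally show ?thesis
      using r by (simp add: field_simps)
  qed
  then have "summable v"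
    by (intro summableI_nonneg_bounded v)
  then show ?thesis
    by (simp add: v_def[abs_def] summable_iff_shift)
qed

text \<open>By monotone convergence the integral of the series is the sum of the integrals. This is
  finite, so the series is finite almost everywhere.\<close>

lemma AE_summable_of_summable_integral:
  fixes f :: "nat \<Rightarrow> 'a \<Rightarrow> real"
  assumes int: "\<And>t. integrable M (f t)" and nonneg: "\<And>t. AE x in M. 0 \<le> f t x"
    and sum: "summable (\<lambda>t. integral\<^sup>L M (f t))"
  shows "AE x in M. summable (\<lambda>t. f t x)"
proof -
  have [measurable]: "f t \<in> borel_measurable M" for t
    using int by auto
  have "(\<integral>\<^sup>+x. (\<Sum>t. ennreal (f t x)) \<partial>M) = (\<Sum>t. \<integral>\<^sup>+x. ennreal (f t x) \<partial>M)"
    by (intro nn_integral_suminf) auto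
  also have "\<dots> = (\<Sum>t. ennreal (integral\<^sup>L M (f t)))"
    using int nonneg by (intro suminf_cong nn_integral_eq_integral)
  also have "\<dots> \<noteq> (\<infinity> :: ennreal)"
    using sum integral_nonneg_AE[OF nonneg] by (simp add: suminf_ennreal2)
  finally have "AE x in M. (\<Sum>t. ennreal (f t x)) \<noteq> \<infinity>"
    by (intro nn_integral_PInf_AE) auto
  moreover have "AE x in M. \<forall>t. 0 \<le> f t x"
    using nonneg by (simp add: AE_all_countable)
  ultimately show ?thesis
    by eventually_elim (auto intro: summable_suminf_not_top)
qed

section \<open>Contraction of moments by conditioning\<close>

text \<open>Since \<open>A\<close> takes values in the unit interval, \<open>A ^ p \<le> A\<close>,
  so a bound on the first conditional moment of \<open>A\<close> suffices for every
  \<open>p\<close>. As \<open>Y ^ p\<close> is \<open>G\<close>-measurable, \<open>A\<close> may be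
  replaced by its conditional expectation inside the integral. Boundedness of \<open>Y\<close>
  supplies the integrability.\<close>

lemma (in prob_space) expectation_affine_power_le:
  fixes Y A :: "'a \<Rightarrow> real"
  assumes G: "subalgebra M G"
    and Y: "Y \<in> borel_measurable G" "AE \<omega> in M. Y \<omega> \<in> {0..B}"
    and A: "A \<in> borel_measurable M" "AE \<omega> in M. A \<omega> \<in> {0..1}"
    and cond: "AE \<omega> in M. real_cond_exp M G A \<omega> \<le> l"
    and c: "0 \<le> c" and p: "0 < p" and \<rho>: "0 \<le> \<rho>"
    and C: "0 \<le> C"
    and ineq: "\<And>x y. 0 \<le> x \<Longrightarrow> 0 \<le> y \<Longrightarrow> (x + y) ^ p \<le> \<rho> * x ^ p + C * y ^ p"
  shows "expectation (\<lambda>\<omega>. (A \<omega> * Y \<omega> + c) ^ p) \<le> \<rho> * l * expectation (\<lambda>\<omega>. Y \<omega> ^ p) + C * c ^ p"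
proof -
  interpret G: finite_measure_subalgebra M G
    using G by unfold_locales
  have [measurable]: "Y \<in> borel_measurable M" "A \<in> borel_measurable M"
    using measurable_from_subalg[OF G Y(1)] A(1) by auto
  have Yp: "AE \<omega> in M. 0 \<le> Y \<omega> ^ p \<and> Y \<omega> ^ p \<le> B ^ p"
    using Y(2) by eventually_elim (auto intro: power_mono)
  have int_Y: "integrable M (\<lambda>\<omega>. Y \<omega> ^ p)"
    by (rule integrable_const_bound[where B = "B ^ p"]) (use Yp in auto)
  have int_YA: "integrable M (\<lambda>\<omega>. Y \<omega> ^ p * A \<omega>)"
  proof (rule integrable_const_bound[where B = "B ^ p"])
    show "AE \<omega> in M. norm (Y \<omega> ^ p * A \<omega>) \<le> B ^ p"
      using Yp A(2)
    proof eventually_elim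
      case (elim \<omega>)
      then have "Y \<omega> ^ p * A \<omega> \<le> B ^ p * 1"
        by (intro mult_mono) auto
      then show ?case
        using elim by (simp add: abs_mult)
    qed
  qed auto
  have cond_int: "integrable M (\<lambda>\<omega>. Y \<omega> ^ p * real_cond_exp M G A \<omega>)"
    "expectation (\<lambda>\<omega>. Y \<omega> ^ p * real_cond_exp M G A \<omega>) = expectation (\<lambda>\<omega>. Y \<omega> ^ p * A \<omega>)"
    using int_YA Y(1) A(1) by (intro G.real_cond_exp_intg; measurable)+
  have "expectation (\<lambda>\<omega>. (A \<omega> * Y \<omega> + c) ^ p) \<le> expectation (\<lambda>\<omega>. \<rho> * (Y \<omega> ^ p * A \<omega>) + C * c ^ p)"
  proof (rule integral_mono_AE')
    show "integrable M (\<lambda>\<omega>. \<rho> * (Y \<omega> ^ p * A \<omega>) + C * c ^ p)"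
      using int_YA by auto
    show "AE \<omega> in M. (A \<omega> * Y \<omega> + c) ^ p \<le> \<rho> * (Y \<omega> ^ p * A \<omega>) + C * c ^ p"
      using Y(2) A(2)
    proof eventually_elim
      case (elim \<omega>)
      have "A \<omega> ^ p \<le> A \<omega> ^ 1"
        using elim p by (intro power_decreasing) auto
      then have "\<rho> * (A \<omega> * Y \<omega>) ^ p \<le> \<rho> * (Y \<omega> ^ p * A \<omega>)"
        using elim \<rho> by (auto simp: power_mult_distrib mult.commute[of "A \<omega>"]
            mult.commute[of "A \<omega> ^ p"] intro!: mult_left_mono)
      then show ?case
        using ineq[of "A \<omega> * Y \<omega>" c] elim c by simp
    qed
    show "AE \<omega> in M. 0 \<le> \<rho> * (Y \<omega> ^ p * A \<omega>) + C * c ^ p"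
      using Y(2) A(2) by eventually_elim (use c C \<rho> in auto)
  qed
  also have "\<dots> = \<rho> * expectation (\<lambda>\<omega>. Y \<omega> ^ p * real_cond_exp M G A \<omega>) + C * c ^ p"
    using int_YA by (simp add: cond_int(2) prob_space)
  also have "expectation (\<lambda>\<omega>. Y \<omega> ^ p * real_cond_exp M G A \<omega>) \<le> expectation (\<lambda>\<omega>. Y \<omega> ^ p * l)"
  proof (rule integral_mono_AE)
    show "AE \<omega> in M. Y \<omega> ^ p * real_cond_exp M G A \<omega> \<le> Y \<omega> ^ p * l"
      using cond Yp by eventually_elim (auto intro: mult_left_mono)
  qed (use int_Y cond_int(1) in auto)
  also have "expectation (\<lambda>\<omega>. Y \<omega> ^ p * l) = l * expectation (\<lambda>\<omega>. Y \<omega> ^ p)"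
    by simp
  finally show ?thesis
    using \<rho> by (simp add: mult_left_mono mult.assoc)
qed

section \<open>The dominating affine recursion\<close>

primrec affine_process :: "real \<Rightarrow> (nat \<Rightarrow> 'a \<Rightarrow> real) \<Rightarrow> (nat \<Rightarrow> real) \<Rightarrow> nat \<Rightarrow> 'a \<Rightarrow> real" where
  "affine_process x a b 0 \<omega> = x"
| "affine_process x a b (Suc t) \<omega> = a (Suc t) \<omega> * affine_process x a b t \<omega> + b t"

text \<open>The upper bound does not depend on \<open>\<omega>\<close>; this later makes every power
  of the process integrable.\<close>

lemma affine_process_bounds:
  assumes "\<And>t. a t \<omega> \<in> {0..1}" "\<And>t. 0 \<le> b t" "0 \<le> x"
  shows "affine_process x a b t \<omega> \<in> {0..x + sum b {..<t}}"
proof (induction t)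
  case (Suc t)
  then have "a (Suc t) \<omega> * affine_process x a b t \<omega> \<le> 1 * (x + sum b {..<t})"
    using assms(1)[of "Suc t"] by (intro mult_mono) auto
  then show ?case
    using Suc assms(1)[of "Suc t"] assms(2)[of t] by auto
qed (use assms in auto)

lemma affine_process_dominates:
  fixes D :: "nat \<Rightarrow> real"
  assumes "\<And>t. 0 \<le> a t \<omega>" "\<And>t. D (Suc t) \<le> a (Suc t) \<omega> * D t + b t" "D 0 \<le> x"
  shows "D t \<le> affine_process x a b t \<omega>"
proof (induction t)
  case (Suc t)
  then have "a (Suc t) \<omega> * D t \<le> a (Suc t) \<omega> * affine_process x a b t \<omega>"
    using assms(1) by (intro mult_left_mono)
  then show ?case
    using assms(2)[of t] by simp
qed (use assms in auto)

lemma affine_process_measurable: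
  assumes "filtration \<Omega> F" "\<And>t. a t \<in> borel_measurable (F t)"
  shows "affine_process x a b t \<in> borel_measurable (F t)"
proof (induction t)
  case 0
  then show ?case
    by (simp add: affine_process.simps(1)[abs_def])
next
  case (Suc t)
  have "subalgebra (F (Suc t)) (F t)"
    using filtration.space_F[OF assms(1)] filtration.sets_F_mono[OF assms(1), of t "Suc t"]
    by (simp add: subalgebra_def)
  then have [measurable]: "affine_process x a b t \<in> borel_measurable (F (Suc t))"
    using Suc by (rule measurable_from_subalg)
  have [measurable]: "a (Suc t) \<in> borel_measurable (F (Suc t))"
    by (rule assms)
  show ?case
    unfolding affine_process.simps(2)[abs_def] by measurable
qed

section \<open>Polynomial decay of the dominating process\<close>

lemma (in prob_space) affine_process_tendsto_0:
  fixes a :: "nat \<Rightarrow> 'a \<Rightarrow> real" and b :: "nat \<Rightarrow> real"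
  assumes filt: "filtration (space M) F" and sub: "\<And>t. subalgebra M (F t)"
    and a_meas: "\<And>t. a t \<in> borel_measurable (F t)"
    and a_range: "\<And>t. AE \<omega> in M. a t \<omega> \<in> {0..1}"
    and lam: "lam < 1"
    and cond: "\<And>t. AE \<omega> in M. real_cond_exp M (F t) (a (Suc t)) \<omega> \<le> lam"
    and b: "\<And>t. 0 \<le> b t" "\<And>t. 1 \<le> t \<Longrightarrow> b t \<le> K * real t powr (- \<beta>')"
    and \<beta>: "0 \<le> \<beta>" "\<beta> < \<beta>'" and x: "0 \<le> x"
  shows "AE \<omega> in M. (\<lambda>t. affine_process x a b t \<omega> * real t powr \<beta>) \<longlonglongrightarrow> 0"
proof -
  define Y where "Y = affine_process x a b"
  obtain p0 :: nat where p0: "1 / (\<beta>' - \<beta>) < real p0"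
    using reals_Archimedean2 by blast
  define p where "p = Suc p0"
  have p: "0 < p" "1 < real p * (\<beta>' - \<beta>)"
    using p0 \<beta> by (auto simp: p_def field_simps)
  \<comment> \<open>\<open>lam\<close> may be zero or negative; the maximum keeps
    \<open>1 / l\<close> meaningful and above 1.\<close>
  define l where "l = max lam (1 / 2)"
  have l: "0 < l" "l < 1" "lam \<le> l"
    using lam by (auto simp: l_def)
  have "1 < sqrt (1 / l)"
    using l by simp
  \<comment> \<open>The factor \<open>\<rho>\<close> is spent twice: once on expanding the power and
    once on the growth of the weight from \<open>t\<close> to \<open>Suc t\<close>. Hence its square
    times \<open>l\<close> has to stay below 1.\<close>
  then obtain \<rho> where \<rho>: "1 < \<rho>" "\<rho> < sqrt (1 / l)"
    using dense by blast
  have "\<rho>\<^sup>2 < (sqrt (1 / l))\<^sup>2"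
    using \<rho> by (intro power_strict_mono) auto
  then have \<rho>l: "\<rho> * (\<rho> * l) < 1"
    using l by (simp add: power2_eq_square field_simps)
  obtain C where C: "0 \<le> C"
    "\<And>x y. 0 \<le> x \<Longrightarrow> 0 \<le> y \<Longrightarrow> (x + y) ^ p \<le> \<rho> * x ^ p + C * y ^ p"
    using power_add_le_weighted[OF \<rho>(1)] by metis
  have Y_meas: "Y t \<in> borel_measurable (F t)" for t
    unfolding Y_def using filt a_meas by (rule affine_process_measurable)
  have Y_meas' [measurable]: "Y t \<in> borel_measurable M" for t
    using sub Y_meas by (rule measurable_from_subalg)
  have "AE \<omega> in M. \<forall>t. a t \<omega> \<in> {0..1}"
    using a_range unfolding AE_all_countable by blast
  then have Y_range: "AE \<omega> in M. Y t \<omega> \<in> {0..x + sum b {..<t}}" for t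
    unfolding Y_def by eventually_elim (rule affine_process_bounds; use b x in blast)
  have int_Y: "integrable M (\<lambda>\<omega>. Y t \<omega> ^ p)" for t
  proof (rule integrable_const_bound[where B = "(x + sum b {..<t}) ^ p"])
    show "AE \<omega> in M. norm (Y t \<omega> ^ p) \<le> (x + sum b {..<t}) ^ p"
      using Y_range[of t] by eventually_elim (auto intro: power_mono)
  qed auto
  define m where "m t = expectation (\<lambda>\<omega>. Y t \<omega> ^ p)" for t
  have m_nonneg: "0 \<le> m t" for t
  proof -
    have "AE \<omega> in M. 0 \<le> Y t \<omega> ^ p"
      using Y_range[of t] by eventually_elim auto
    then show ?thesis
      unfolding m_def by (rule integral_nonneg_AE)
  qed
  have m_step: "m (Suc t) \<le> \<rho> * l * m t + C * b t ^ p" for t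
  proof -
    have "m (Suc t) = expectation (\<lambda>\<omega>. (a (Suc t) \<omega> * Y t \<omega> + b t) ^ p)"
      by (simp add: m_def Y_def)
    also have "\<dots> \<le> \<rho> * l * m t + C * b t ^ p"
      unfolding m_def
    proof (rule expectation_affine_power_le[OF sub Y_meas Y_range _ a_range _ b(1) p(1) _ C])
      show "a (Suc t) \<in> borel_measurable M"
        using sub a_meas by (rule measurable_from_subalg)
      show "AE \<omega> in M. real_cond_exp M (F t) (a (Suc t)) \<omega> \<le> l"
        using cond[of t] by eventually_elim (use l in auto)
    qed (use \<rho> in auto)
    finally show ?thesis .
  qed
  \<comment> \<open>\<open>w\<close> is the weight on the moments \<open>m\<close>, and
    \<open>d\<close> will be the forcing term of the weighted recursion. Since
    \<open>0 powr \<beta> = 0\<close>, also \<open>w 0 = 0\<close>, so the weight comparison can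
    only hold from \<open>t = 1\<close> on.\<close>
  define w where "w t = (real t powr \<beta>) ^ p" for t
  define d where "d t = \<rho> * C * K ^ p * real t powr (- (real p * (\<beta>' - \<beta>)))" for t
  have w_nonneg: "0 \<le> w t" for t
    by (simp add: w_def)
  have "(\<lambda>t. (real (Suc t) powr \<beta> / real t powr \<beta>) ^ p) \<longlonglongrightarrow> 1 ^ p"
    by (intro tendsto_power) real_asymp
  then have "eventually (\<lambda>t. (real (Suc t) powr \<beta> / real t powr \<beta>) ^ p < \<rho>) sequentially"
    using \<rho> by (intro order_tendstoD(2)[where y = "1 ^ p"]) auto
  then have w_step: "eventually (\<lambda>t. w (Suc t) \<le> \<rho> * w t) sequentially"
    using eventually_gt_at_top[of 0]
    by eventually_elim (auto simp: w_def power_divide field_simps)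
  have K: "0 \<le> K"
    using b(1)[of 1] b(2)[of 1] by simp
  have "summable (\<lambda>t. w t * m t)"
  proof (rule summable_of_contraction)
    show "\<rho> * (\<rho> * l) < 1"
      by (rule \<rho>l)
    show "summable d"
      \<comment> \<open>The choice of \<open>p\<close> makes the exponent smaller than -1.\<close>
      unfolding d_def using p by (intro summable_mult) (simp add: summable_real_powr_iff)
    show "0 \<le> d t" for t
      using \<rho> C K by (simp add: d_def)
    show "eventually (\<lambda>t. w (Suc t) * m (Suc t) \<le> \<rho> * (\<rho> * l) * (w t * m t) + d t) sequentially"
      using w_step eventually_ge_at_top[of 1]
    proof eventually_elim
      case (elim t)
      have "w (Suc t) * m (Suc t) \<le> (\<rho> * w t) * (\<rho> * l * m t + C * b t ^ p)"
        using elim m_step m_nonneg w_nonneg \<rho> by (intro mult_mono) auto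
      \<comment> \<open>The weight uses up \<open>\<beta>\<close> of the decay rate
        \<open>\<beta>'\<close> of \<open>b\<close>; the remaining rate
        \<open>\<beta>' - \<beta>\<close> is multiplied by \<open>p\<close>.\<close>
      moreover have "w t * b t ^ p \<le> K ^ p * real t powr (- (real p * (\<beta>' - \<beta>)))"
      proof -
        have "b t * real t powr \<beta> \<le> K * real t powr (- \<beta>') * real t powr \<beta>"
          using b elim by (intro mult_right_mono) auto
        also have "\<dots> = K * real t powr (- (\<beta>' - \<beta>))"
          using elim by (simp flip: powr_add)
        finally have "(b t * real t powr \<beta>) ^ p \<le> (K * real t powr (- (\<beta>' - \<beta>))) ^ p"
          using b(1) by (intro power_mono) auto
        also have "(real t powr (- (\<beta>' - \<beta>))) ^ p = real t powr (- (\<beta>' - \<beta>) * real p)"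
          using elim by (simp add: powr_powr flip: powr_realpow)
        then have "(K * real t powr (- (\<beta>' - \<beta>))) ^ p = K ^ p * real t powr (- (real p * (\<beta>' - \<beta>)))"
          by (simp add: power_mult_distrib algebra_simps)
        finally show ?thesis
          by (simp add: w_def power_mult_distrib mult.commute)
      qed
      then have "\<rho> * C * (w t * b t ^ p) \<le> d t"
        unfolding d_def mult.assoc using \<rho> C by (intro mult_left_mono) auto
      ultimately show ?case
        by (simp add: algebra_simps)
    qed
  qed (simp add: w_nonneg m_nonneg)
  moreover have "expectation (\<lambda>\<omega>. (Y t \<omega> * real t powr \<beta>) ^ p) = w t * m t" for t
    using int_Y by (simp add: power_mult_distrib w_def m_def mult.commute)
  moreover have "integrable M (\<lambda>\<omega>. (Y t \<omega> * real t powr \<beta>) ^ p)" for t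
    using int_Y by (simp add: power_mult_distrib)
  moreover have "AE \<omega> in M. 0 \<le> (Y t \<omega> * real t powr \<beta>) ^ p" for t
    using Y_range[of t] by eventually_elim auto
  ultimately have "AE \<omega> in M. summable (\<lambda>t. (Y t \<omega> * real t powr \<beta>) ^ p)"
    by (intro AE_summable_of_summable_integral) auto
  then show ?thesis
    \<comment> \<open>The terms of a convergent series tend to 0, and since \<open>p > 0\<close> so
      do their bases.\<close>
    by eventually_elim (use p in \<open>auto dest!: summable_LIMSEQ_zero simp: power_tendsto_0_iff Y_def\<close>)
qed

section \<open>Transfer to the process \<open>D\<close>\<close>

theorem lemma10:
  fixes M :: "'a measure"
    and F :: "nat \<Rightarrow> 'a measure"
    and D a :: "nat \<Rightarrow> 'a \<Rightarrow> real"
    and b :: "nat \<Rightarrow> real"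
    and lam K \<beta>' \<beta> :: real
  assumes "prob_space M"
    and "filtration (space M) F"
    and "\<And>t. subalgebra M (F t)"
    and "\<And>t. D t \<in> borel_measurable M"
    and "\<And>t. AE \<omega> in M. 0 \<le> D t \<omega>"
    and "\<And>t. AE \<omega> in M. D (t + 1) \<omega> \<le> a (t + 1) \<omega> * D t \<omega> + b t"
    and "adapted_process F a"
    and "\<And>t. AE \<omega> in M. a t \<omega> \<in> {0..1}"
    and "lam < 1"
    and "\<And>t. AE \<omega> in M. real_cond_exp M (F t) (a (t + 1)) \<omega> \<le> lam"
    and "\<And>t. 0 \<le> b t"
    and "0 < K" and "0 < \<beta>'"
    and "\<And>t. 1 \<le> t \<Longrightarrow> b t \<le> K * real t powr (- \<beta>')"
    and "\<beta> < \<beta>'"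
  shows "AE \<omega> in M. (\<lambda>t. D t \<omega> * real t powr \<beta>) \<longlonglongrightarrow> 0"
proof -
  interpret prob_space M by fact
  \<comment> \<open>A negative \<open>\<beta>\<close> is reduced to exponent 0, which still lies
    below \<open>\<beta>'\<close>.\<close>
  define \<gamma> where "\<gamma> = max \<beta> 0"
  have \<gamma>: "0 \<le> \<gamma>" "\<beta> \<le> \<gamma>" "\<gamma> < \<beta>'"
    using assms by (auto simp: \<gamma>_def)
  \<comment> \<open>Only countably many initial values are used, so one null set serves them all,
    and \<open>n\<close> may afterwards be chosen depending on \<open>\<omega>\<close> to exceed
    \<open>D 0 \<omega>\<close>.\<close>
  have "AE \<omega> in M. (\<lambda>t. affine_process (real n) a b t \<omega> * real t powr \<gamma>) \<longlonglongrightarrow> 0" for n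
    by (rule affine_process_tendsto_0[where F = F and lam = lam and K = K and \<beta>' = \<beta>'])
      (use assms \<gamma> in \<open>auto simp: adapted_process_def\<close>)
  then have "AE \<omega> in M. \<forall>n. (\<lambda>t. affine_process (real n) a b t \<omega> * real t powr \<gamma>) \<longlonglongrightarrow> 0"
    by (simp add: AE_all_countable)
  moreover have "AE \<omega> in M. \<forall>t. 0 \<le> D t \<omega>"
    using assms(5) by (simp add: AE_all_countable)
  moreover have "AE \<omega> in M. \<forall>t. D (Suc t) \<omega> \<le> a (Suc t) \<omega> * D t \<omega> + b t"
    using assms(6) by (simp add: AE_all_countable)
  moreover have "AE \<omega> in M. \<forall>t. a t \<omega> \<in> {0..1}"
    using assms(8) unfolding AE_all_countable by blast
  ultimately show ?thesis
  proof eventually_elim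
    case (elim \<omega>)
    obtain n :: nat where n: "D 0 \<omega> \<le> real n"
      using real_arch_simple by blast
    have dom: "D t \<omega> \<le> affine_process (real n) a b t \<omega>" for t
      by (rule affine_process_dominates[where D = "\<lambda>t. D t \<omega>"]) (use elim n in auto)
    show ?case
    proof (rule tendsto_sandwich[where f = "\<lambda>_. 0"])
      show "eventually (\<lambda>t. 0 \<le> D t \<omega> * real t powr \<beta>) sequentially"
        using elim by simp
      show "eventually (\<lambda>t. D t \<omega> * real t powr \<beta> \<le> affine_process (real n) a b t \<omega> * real t powr \<gamma>)
          sequentially"
        \<comment> \<open>For base at least 1, \<open>powr\<close> is monotone in the exponent, so
          \<open>\<beta>\<close> may be raised to \<open>\<gamma>\<close>.\<close>
        using eventually_ge_at_top[of 1]
      proof eventually_elim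
        case (elim t)
        have "0 \<le> D t \<omega>"
          using \<open>\<forall>t. 0 \<le> D t \<omega>\<close> by blast
        then show ?case
          using dom[of t] elim \<gamma> by (intro mult_mono powr_mono) auto
      qed
    qed (use elim in auto)
  qed
qed

end
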